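(* For $c\ge2$, let $(u^c(s),v^c(s))$, $s\in\mathbb{R}$, be the time parametrization of the heteroclinic orbit, connecting $(0,0)$ and $(1,0)$, of the planar system $$\dot u=v,\qquad \dot v=-cv-u(1-u),$$ chosen such that $u^c(0)=1/2$. Define $$U^c(s)=\frac{3+2\sqrt2}{\left(1+\sqrt2+e^{(\sqrt{c^2+4}-c)s/2}\right)^2}.$$ Then: (i) when $2\le c<5/\sqrt6$, $\operatorname{sgn}(u^c(s)-U^c(s))=-\operatorname{sgn}(s)$ for all $s\in\mathbb{R}$; (ii) when $c=5/\sqrt6$, $u^c(s)=U^c(s)$ for all $s\in\mathbb{R}$; (iii) when $c>5/\sqrt6$, $\operatorname{sgn}(u^c(s)-U^c(s))=\operatorname{sgn}(s)$ for all $s\in\mathbb{R}$.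
   Context: The dot denotes the derivative with respect to $s$. The heteroclinic orbit is the branch of the unstable separatrix of the saddle $(1,0)$ that tends to the attracting node $(0,0)$ as $s\to+\infty$ (and to $(1,0)$ as $s\to-\infty$). Here $\operatorname{sgn}$ is the sign function, with $\operatorname{sgn}(0)=0$. *)

theory Defs
  imports Complex_Main
begin

definition kpp_solution :: "real \<Rightarrow> (real \<Rightarrow> real) \<Rightarrow> (real \<Rightarrow> real) \<Rightarrow> bool" where
  "kpp_solution c u v \<longleftrightarrow>
     (\<forall>s. (u has_real_derivative v s) (at s) \<and>
          (v has_real_derivative (- c * v s - u s * (1 - u s))) (at s))"

(* A parametrized orbit leaving the saddle (1,0) and entering the node (0,0).  A non-constant
   solution that tends to (1,0) at minus infinity is, by definition, a parametrization of a branch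
   of the unstable separatrix of the saddle; the limit (0,0) at plus infinity selects the branch
   (and rules out the constant solution).  For c >= 2 it is unique up to a time shift. *)
definition kpp_heteroclinic :: "real \<Rightarrow> (real \<Rightarrow> real) \<Rightarrow> (real \<Rightarrow> real) \<Rightarrow> bool" where
  "kpp_heteroclinic c u v \<longleftrightarrow>
     kpp_solution c u v \<and>
     ((\<lambda>s. (u s, v s)) \<longlongrightarrow> (1, 0)) at_bot \<and>
     ((\<lambda>s. (u s, v s)) \<longlongrightarrow> (0, 0)) at_top"

definition U_approx :: "real \<Rightarrow> real \<Rightarrow> real" where
  "U_approx c s =
     (3 + 2 * sqrt 2) / (1 + sqrt 2 + exp ((sqrt (c\<^sup>2 + 4) - c) * s / 2))\<^sup>2"

end

theory Submission
  imports Defs "HOL-Analysis.Elementary_Metric_Spaces"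
begin

text \<open>
  Let \<open>\<lambda>\<close> be the positive root of \<open>\<lambda>\<^sup>2 + c \<lambda> = 1\<close>, the unstable eigenvalue of the saddle. The explicit
  profile runs along the curve \<open>v = - 2 \<lambda> u (1 - \<surd>u)\<close>. On the heteroclinic orbit the defect
  \<open>z = v + 2 \<lambda> u (1 - \<surd>u)\<close> satisfies the linear equation
  \<open>z' = - (c - 2 \<lambda> + 3 \<lambda> \<surd>u) z + (1 - 6 \<lambda>\<^sup>2) u (1 - \<surd>u)\<^sup>2\<close> with a positive damping coefficient, and
  it vanishes at minus infinity; hence it has the sign of \<open>1 - 6 \<lambda>\<^sup>2\<close>, which is that of \<open>c - 5 / \<surd>6\<close>.
  The quantity \<open>(1 / \<surd>u - 1) exp (- \<lambda> s)\<close> is constant along the profile, and along the orbit its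
  derivative has the sign opposite to \<open>z\<close>.
\<close>

section \<open>Propagation of signs from minus infinity\<close>

lemma nonneg_of_deriv_nonneg_of_tendsto_at_bot:
  fixes f f' :: "real \<Rightarrow> real"
  assumes deriv: "\<And>s. s < a \<Longrightarrow> (f has_real_derivative f' s) (at s)"
    and nonneg: "\<And>s. s < a \<Longrightarrow> f' s \<ge> 0"
    and lim: "(f \<longlongrightarrow> 0) at_bot"
    and "s < a"
  shows "f s \<ge> 0"
proof (rule tendsto_upperbound[OF lim])
  have "f t \<le> f s" if "t \<le> s" for t
    by (rule DERIV_nonneg_imp_nondecreasing[OF that]) (use deriv nonneg \<open>s < a\<close> in \<open>meson le_less_trans\<close>)
  then show "\<forall>\<^sub>F t in at_bot. f t \<le> f s"
    using eventually_le_at_bot by (rule eventually_mono[rotated])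
qed simp

text \<open>If \<open>f s \<le> 0\<close>, then \<open>f\<close> is negative at some
  \<open>r\<close> just left of \<open>s\<close>, yet it exceeds \<open>f r\<close> at some earlier
  \<open>t\<close>. Its minimum over \<open>[t, r]\<close> then lies at a point \<open>m > t\<close>
  with \<open>f m \<le> 0\<close>, and the positive derivative there yields a smaller value to the
  left.\<close>

lemma pos_of_deriv_pos_of_tendsto_at_bot:
  fixes f f' :: "real \<Rightarrow> real"
  assumes deriv: "\<And>s. (f has_real_derivative f' s) (at s)"
    and pos: "\<And>s. f s \<le> 0 \<Longrightarrow> f' s > 0"
    and lim: "(f \<longlongrightarrow> 0) at_bot"
  shows "f s > 0"
proof (rule ccontr)
  assume "\<not> f s > 0"
  then have "f s \<le> 0" by simp
  then obtain d where d: "d > 0" "\<And>h. h > 0 \<Longrightarrow> h < d \<Longrightarrow> f (s - h) < f s"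
    using DERIV_pos_inc_left[OF deriv pos] by blast
  define r where "r = s - d / 2"
  have r: "f r < 0"
    using d(2)[of "d / 2"] d(1) \<open>f s \<le> 0\<close> by (simp add: r_def)
  have "\<forall>\<^sub>F t in at_bot. f t > f r \<and> t \<le> r"
    using order_tendstoD(1)[OF lim r] eventually_le_at_bot by (rule eventually_conj)
  then obtain t where t: "f t > f r" "t \<le> r"
    by (auto simp: eventually_at_bot_linorder)
  have "\<forall>x. t \<le> x \<and> x \<le> r \<longrightarrow> isCont f x"
    using deriv DERIV_isCont by blast
  from isCont_eq_Lb[OF t(2) this]
  obtain m where m: "t \<le> m" "m \<le> r" "\<And>x. t \<le> x \<Longrightarrow> x \<le> r \<Longrightarrow> f m \<le> f x"
    by blast
  have "f m \<le> f r" using m(3) t(2) by simp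
  then have "f m \<le> 0" and "t < m" using r t m(1) by (force, force simp: less_le)
  obtain e where e: "e > 0" "\<And>h. h > 0 \<Longrightarrow> h < e \<Longrightarrow> f (m - h) < f m"
    using DERIV_pos_inc_left[OF deriv pos[OF \<open>f m \<le> 0\<close>]] by blast
  define h where "h = min (e / 2) (m - t)"
  have "h > 0" "h < e" "t \<le> m - h"
    using e(1) \<open>t < m\<close> by (auto simp: h_def)
  then show False
    using e(2)[of h] m(3)[of "m - h"] m(2) by force
qed

lemma tendsto_exp_mult_at_bot:
  fixes f :: "real \<Rightarrow> real"
  assumes "(f \<longlongrightarrow> l) at_bot" and "k > 0"
  shows "((\<lambda>s. exp (k * s) * f s) \<longlongrightarrow> 0) at_bot"
proof -
  have "filterlim (\<lambda>s. k * s) at_bot at_bot"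
    using filterlim_tendsto_pos_mult_at_bot[OF tendsto_const \<open>k > 0\<close> filterlim_ident] .
  then have "((\<lambda>s. exp (k * s)) \<longlongrightarrow> 0) at_bot"
    by (rule filterlim_compose[OF exp_at_bot])
  from tendsto_mult[OF this assms(1)] show ?thesis by simp
qed

section \<open>The unstable eigenvalue and the critical speed\<close>

definition unstable_eigenvalue :: "real \<Rightarrow> real" where
  "unstable_eigenvalue c = (sqrt (c\<^sup>2 + 4) - c) / 2"

lemma unstable_eigenvalue_pos: "unstable_eigenvalue c > 0"
proof -
  have "c \<le> \<bar>c\<bar>" by simp
  also have "\<bar>c\<bar> = sqrt (c\<^sup>2)" by simp
  also have "\<dots> < sqrt (c\<^sup>2 + 4)" by (rule real_sqrt_less_mono) simp
  finally show ?thesis by (simp add: unstable_eigenvalue_def)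
qed

lemma unstable_eigenvalue_eq:
  "(unstable_eigenvalue c)\<^sup>2 + c * unstable_eigenvalue c = 1"
proof -
  have "(sqrt (c\<^sup>2 + 4))\<^sup>2 = c\<^sup>2 + 4" by (simp add: add_nonneg_pos less_imp_le)
  then show ?thesis
    by (simp add: unstable_eigenvalue_def power2_eq_square field_simps)
qed

text \<open>With \<open>m = sqrt 6 * l\<close> and \<open>c * l = 1 - l\<^sup>2\<close>, a positive
  multiple of the left argument factors as \<open>(1 - m) * (6 + m)\<close>, and the right one is
  \<open>(1 - m) * (1 + m)\<close>; both have the sign of \<open>1 - m\<close>.\<close>

lemma sgn_speed_minus_critical:
  "sgn (c - 5 / sqrt 6) = sgn (1 - 6 * (unstable_eigenvalue c)\<^sup>2)"
proof -
  define l where "l = unstable_eigenvalue c"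
  define m where "m = sqrt 6 * l"
  have l: "l > 0" "l\<^sup>2 + c * l = 1"
    unfolding l_def by (rule unstable_eigenvalue_pos, rule unstable_eigenvalue_eq)
  have m: "m > 0" "m\<^sup>2 = 6 * l\<^sup>2"
    using l by (simp_all add: m_def power_mult_distrib)
  have s6: "sqrt 6 * sqrt 6 = 6" by simp
  have "(c - 5 / sqrt 6) * (sqrt 6 * m) = 6 * (c * l) - 5 * m"
    unfolding m_def using s6 by (simp add: field_simps)
  also have "\<dots> = 6 - m\<^sup>2 - 5 * m"
    using l(2) m(2) by simp
  also have "\<dots> = (1 - m) * (6 + m)"
    by (simp add: power2_eq_square algebra_simps)
  finally have "sgn ((c - 5 / sqrt 6) * (sqrt 6 * m)) = sgn ((1 - m) * (6 + m))"
    by simp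
  then have "sgn (c - 5 / sqrt 6) = sgn (1 - m)"
    using m(1) by (simp add: sgn_mult)
  also have "1 - 6 * l\<^sup>2 = (1 - m) * (1 + m)"
    unfolding m(2)[symmetric] by (simp add: power2_eq_square algebra_simps)
  then have "sgn (1 - m) = sgn (1 - 6 * l\<^sup>2)"
    using m(1) by (simp add: sgn_mult)
  finally show ?thesis by (simp add: l_def)
qed

section \<open>The orbit stays in the strip 0 < u < 1\<close>

lemma kpp_heteroclinicD:
  assumes "kpp_heteroclinic c u v"
  shows "(u has_real_derivative v s) (at s)"
    and "(v has_real_derivative (- c * v s - u s * (1 - u s))) (at s)"
    and "(u \<longlongrightarrow> 1) at_bot" "(v \<longlongrightarrow> 0) at_bot" "(u \<longlongrightarrow> 0) at_top"
  using assms tendsto_fst[of "\<lambda>s. (u s, v s)"] tendsto_snd[of "\<lambda>s. (u s, v s)"]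
  unfolding kpp_heteroclinic_def kpp_solution_def by (force+)

text \<open>With \<open>w = 1 - u\<close> one has \<open>w'' + c w' = w - w\<^sup>2 \<le> w\<close>, so \<open>w' - \<lambda> w\<close> decreases after
  multiplication by \<open>exp ((c + \<lambda>) s)\<close> and is therefore nonpositive.\<close>

lemma kpp_heteroclinic_less_1:
  assumes "c \<ge> 0" and het: "kpp_heteroclinic c u v"
  shows "u s < 1"
proof -
  note D = kpp_heteroclinicD[OF het]
  define l where "l = unstable_eigenvalue c"
  have l: "l > 0" "l\<^sup>2 + c * l = 1"
    unfolding l_def by (rule unstable_eigenvalue_pos, rule unstable_eigenvalue_eq)
  define x where "x = (\<lambda>s. v s + l * (1 - u s))"
  have x: "x r \<ge> 0" for r
  proof -
    \<comment> \<open>The comparison lemma speaks of points strictly below \<open>a\<close>;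
      \<open>a = r + 1\<close> brings in \<open>r\<close> itself.\<close>
    have "0 \<le> exp ((c + l) * r) * x r"
    proof (rule nonneg_of_deriv_nonneg_of_tendsto_at_bot[where a = "r + 1"
          and f = "\<lambda>s. exp ((c + l) * s) * x s"])
      fix t
      have "(c + l) * x t + (- c * v t - u t * (1 - u t)) - l * v t
          = (l\<^sup>2 + c * l) * (1 - u t) - u t * (1 - u t)"
        by (simp add: x_def power2_eq_square algebra_simps)
      also have "\<dots> = (1 - u t)\<^sup>2"
        unfolding l(2) by (simp add: power2_eq_square algebra_simps)
      finally have eq: "(c + l) * x t + (- c * v t - u t * (1 - u t)) - l * v t = (1 - u t)\<^sup>2" .
      have "((\<lambda>s. exp ((c + l) * s) * x s) has_real_derivative
          exp ((c + l) * t) * ((c + l) * x t + (- c * v t - u t * (1 - u t)) - l * v t)) (at t)"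
        unfolding x_def by (auto intro!: derivative_eq_intros D simp: algebra_simps)
      then show "((\<lambda>s. exp ((c + l) * s) * x s) has_real_derivative
          exp ((c + l) * t) * (1 - u t)\<^sup>2) (at t)"
        unfolding eq .
      show "exp ((c + l) * t) * (1 - u t)\<^sup>2 \<ge> 0" by simp
    next
      have "(x \<longlongrightarrow> 0 + l * (1 - 1)) at_bot"
        unfolding x_def by (intro tendsto_intros D)
      then show "((\<lambda>s. exp ((c + l) * s) * x s) \<longlongrightarrow> 0) at_bot"
        by (rule tendsto_exp_mult_at_bot) (use l(1) \<open>c \<ge> 0\<close> in simp)
      show "r < r + 1" by simp
    qed
    then show ?thesis by (simp add: zero_le_mult_iff)
  qed
  \<comment> \<open>Since \<open>u\<close> tends to 0, \<open>1 - u\<close> is positive at some late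
    time \<open>t\<close>. This is carried back to \<open>s\<close>, because
    \<open>exp (- l * s) * (1 - u s)\<close> has derivative
    \<open>- exp (- l * s) * x s \<le> 0\<close>.\<close>
  have "\<forall>\<^sub>F t in at_top. u t < 1 \<and> t \<ge> s"
    using order_tendstoD(2)[OF D(5), of 1] eventually_ge_at_top[of s] by (simp add: eventually_conj)
  then obtain t where t: "u t < 1" "s \<le> t"
    by (auto simp: eventually_at_top_linorder)
  have "exp (- l * t) * (1 - u t) \<le> exp (- l * s) * (1 - u s)"
  proof (rule DERIV_nonpos_imp_nonincreasing[OF t(2)])
    fix r
    have "((\<lambda>s. exp (- l * s) * (1 - u s)) has_real_derivative - exp (- l * r) * x r) (at r)"
      unfolding x_def by (auto intro!: derivative_eq_intros D simp: algebra_simps)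
    moreover have "- exp (- l * r) * x r \<le> 0"
      using x by simp
    ultimately show "\<exists>y. ((\<lambda>s. exp (- l * s) * (1 - u s)) has_real_derivative y) (at r) \<and> y \<le> 0"
      by blast
  qed
  moreover have "0 < exp (- l * t) * (1 - u t)"
    using t by simp
  ultimately have "0 < exp (- l * s) * (1 - u s)"
    by linarith
  then show ?thesis by (simp add: zero_less_mult_iff)
qed

text \<open>The function \<open>Y = u exp (c s / 2)\<close> solves \<open>Y'' = (c\<^sup>2 / 4 - 1 + u) Y\<close>, so for \<open>c \<ge> 2\<close> it is
  convex, hence increasing, up to the first zero of \<open>u\<close>, which is then impossible.\<close>

lemma kpp_heteroclinic_pos:
  assumes c: "c \<ge> 2" and het: "kpp_heteroclinic c u v"
  shows "u s > 0"
proof (rule ccontr)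
  note D = kpp_heteroclinicD[OF het]
  define Z where "Z = {s. u s \<le> 0}"
  assume "\<not> u s > 0"
  then have "Z \<noteq> {}" by (auto simp: Z_def not_less)
  have "\<forall>\<^sub>F t in at_bot. u t > 0"
    using order_tendstoD(1)[OF D(3)] by simp
  then obtain b where b: "\<And>t. t \<le> b \<Longrightarrow> u t > 0"
    by (auto simp: eventually_at_bot_linorder)
  have bdd: "bdd_below Z"
    by (rule bdd_belowI[of _ b]) (use b in \<open>force simp: Z_def dest: leD intro: leI\<close>)
  have "closed Z"
    unfolding Z_def
    by (intro closed_Collect_le continuous_on_const continuous_at_imp_continuous_on)
      (use D(1) DERIV_isCont in blast)
  define a where "a = Inf Z"
  have "a \<in> Z"
    unfolding a_def using \<open>Z \<noteq> {}\<close> bdd \<open>closed Z\<close> by (rule closed_contains_Inf)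
  then have ua: "u a \<le> 0" by (simp add: Z_def)
  have pos: "u t > 0" if "t < a" for t
    using cInf_lower[OF _ bdd, of t] that by (force simp: Z_def a_def)
  \<comment> \<open>Chosen so that \<open>exp (c / 2 * s) * g s\<close> is the derivative of
    \<open>Y\<close>.\<close>
  define g where "g = (\<lambda>s. v s + c / 2 * u s)"
  have g: "g r \<ge> 0" if "r < a" for r
  proof -
    have "0 \<le> exp (c / 2 * r) * g r"
    proof (rule nonneg_of_deriv_nonneg_of_tendsto_at_bot[OF _ _ _ that,
          where f = "\<lambda>s. exp (c / 2 * s) * g s"])
      fix t assume "t < a"
      show "((\<lambda>s. exp (c / 2 * s) * g s) has_real_derivative
          exp (c / 2 * t) * (((c / 2)\<^sup>2 - 1 + u t) * u t)) (at t)"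
        unfolding g_def by (auto intro!: derivative_eq_intros D simp: algebra_simps power2_eq_square)
      \<comment> \<open>Here \<open>c \<ge> 2\<close> enters: the origin is a node and not a focus,
        so \<open>u\<close> cannot oscillate around 0.\<close>
      have "1\<^sup>2 \<le> (c / 2)\<^sup>2" using c by (intro power_mono) auto
      then show "exp (c / 2 * t) * (((c / 2)\<^sup>2 - 1 + u t) * u t) \<ge> 0"
        using pos[OF \<open>t < a\<close>] by simp
    next
      have "(g \<longlongrightarrow> 0 + c / 2 * 1) at_bot"
        unfolding g_def by (intro tendsto_intros D)
      then show "((\<lambda>s. exp (c / 2 * s) * g s) \<longlongrightarrow> 0) at_bot"
        by (rule tendsto_exp_mult_at_bot) (use c in simp)
    qed
    then show ?thesis by (simp add: zero_le_mult_iff)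
  qed
  let ?Y = "\<lambda>s. exp (c / 2 * s) * u s"
  have Y: "(?Y has_real_derivative exp (c / 2 * t) * g t) (at t)" for t
    unfolding g_def by (auto intro!: derivative_eq_intros D simp: algebra_simps)
  \<comment> \<open>Any point before \<open>a\<close> would serve. The sign of \<open>g\<close> is
    known only to the left of \<open>a\<close>, hence monotonicity from the open interval.\<close>
  have "?Y (a - 1) \<le> ?Y a"
  proof (rule DERIV_nonneg_imp_increasing_open[where f = ?Y])
    show "\<exists>y. (?Y has_real_derivative y) (at t) \<and> 0 \<le> y" if "a - 1 < t" "t < a" for t
      using Y[of t] g[OF that(2)] by fastforce
    show "continuous_on {a - 1..a} ?Y"
      using Y DERIV_isCont by (blast intro: continuous_at_imp_continuous_on)
  qed simp
  moreover have "?Y (a - 1) > 0" using pos by simp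
  moreover have "?Y a \<le> 0" using ua by (simp add: mult_le_0_iff)
  ultimately show False by linarith
qed

section \<open>Sign of the defect along the orbit\<close>

definition profile_defect :: "real \<Rightarrow> (real \<Rightarrow> real) \<Rightarrow> (real \<Rightarrow> real) \<Rightarrow> real \<Rightarrow> real" where
  "profile_defect c u v s = v s + 2 * unstable_eigenvalue c * (u s * (1 - sqrt (u s)))"

lemma sgn_profile_defect:
  assumes c: "c \<ge> 2" and het: "kpp_heteroclinic c u v"
  shows "sgn (profile_defect c u v s) = sgn (1 - 6 * (unstable_eigenvalue c)\<^sup>2)"
proof -
  note D = kpp_heteroclinicD[OF het]
  define l where "l = unstable_eigenvalue c"
  have l: "l > 0" "l\<^sup>2 + c * l = 1"
    unfolding l_def by (rule unstable_eigenvalue_pos, rule unstable_eigenvalue_eq)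
  \<comment> \<open>The bound \<open>2 * l < 1\<close> gives \<open>c - 2 * l > 0\<close>, which
    makes the damping \<open>b\<close> positive.\<close>
  have "2 * l \<le> c * l" using c l(1) by simp
  moreover have "l\<^sup>2 > 0" using l(1) by simp
  ultimately have "2 * l < 1" using l(2) by linarith
  define k where "k = 1 - 6 * l\<^sup>2"
  define z where "z = profile_defect c u v"
  define b where "b = (\<lambda>s. c - 2 * l + 3 * l * sqrt (u s))"
  define f where "f = (\<lambda>s. u s * (1 - sqrt (u s))\<^sup>2)"
  have u: "u t > 0" "u t < 1" for t
    using kpp_heteroclinic_pos[OF c het] kpp_heteroclinic_less_1[OF _ het] c by auto
  have b: "b t > 0" for t
    using c \<open>2 * l < 1\<close> l(1) u(1)[of t] by (simp add: b_def add_pos_nonneg)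
  have f: "f t > 0" for t
    using u[of t] by (simp add: f_def)
  have dz: "(z has_real_derivative - b t * z t + k * f t) (at t)" for t
  proof -
    \<comment> \<open>An opaque name for the square root, so that differentiation uses
      \<open>dr\<close> and everything becomes rational in \<open>r\<close>.\<close>
    define \<rho> where "\<rho> = (\<lambda>s. sqrt (u s))"
    define r where "r = sqrt (u t)"
    have r: "r > 0" "u t = r\<^sup>2" using u(1)[of t] by (simp_all add: r_def)
    have "((\<lambda>s. sqrt (u s)) has_real_derivative v t / (2 * r)) (at t)"
      using DERIV_chain2[OF DERIV_real_sqrt[OF u(1)] D(1), of t] by (simp add: r_def field_simps)
    then have dr: "((\<lambda>s. \<rho> s) has_real_derivative v t / (2 * r)) (at t)"
      by (simp add: \<rho>_def)
    have \<rho>: "\<rho> t = r" "z = (\<lambda>s. v s + 2 * l * (u s * (1 - \<rho> s)))"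
      by (simp_all add: fun_eq_iff z_def profile_defect_def l_def \<rho>_def r_def)
    have "(z has_real_derivative - c * v t - u t * (1 - u t)
        + 2 * l * (v t * (1 - r) - u t * (v t / (2 * r)))) (at t)"
      unfolding \<rho>(2) by (auto intro!: derivative_eq_intros D dr simp: \<rho>(1) algebra_simps)
    moreover have "u t * (v t / (2 * r)) = r * v t / 2"
      using r by (simp add: power2_eq_square)
    moreover have "- c * v t - u t * (1 - u t) + 2 * l * (v t * (1 - r) - r * v t / 2)
        = - b t * z t + k * f t"
    proof -
      have "- c * v t - r\<^sup>2 * (1 - r\<^sup>2) + l * (2 * (v t * (1 - r)) - r * v t)
        = - (c - 2 * l + 3 * l * r) * (v t + 2 * l * (r\<^sup>2 * (1 - r)))
          + (1 - 6 * l\<^sup>2) * (r\<^sup>2 * (1 - r)\<^sup>2)"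
        using l(2) by algebra
      then show ?thesis
        unfolding b_def z_def f_def k_def profile_defect_def l_def[symmetric] r_def[symmetric]
        unfolding r(2) by (simp add: algebra_simps)
    qed
    ultimately show ?thesis by (simp only:)
  qed
  have "(z \<longlongrightarrow> 0 + 2 * l * (1 * (1 - sqrt 1))) at_bot"
    unfolding z_def profile_defect_def l_def[symmetric] by (intro tendsto_intros D)
  then have lim: "(z \<longlongrightarrow> 0) at_bot" by simp
  \<comment> \<open>The strict comparison applies to \<open>z\<close> or to \<open>- z\<close>,
    according to the sign of the forcing. Without forcing, \<open>- (z s)\<^sup>2\<close> is
    nondecreasing from its limit 0, so \<open>z\<close> vanishes.\<close>
  consider "k > 0" | "k < 0" | "k = 0" by linarith
  then have "sgn (z s) = sgn k"
  proof cases
    case 1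
    have "z s > 0"
    proof (rule pos_of_deriv_pos_of_tendsto_at_bot[OF dz _ lim])
      fix t assume "z t \<le> 0"
      then have "- b t * z t \<ge> 0" using b[of t] by (simp add: mult_le_0_iff)
      moreover have "k * f t > 0" using 1 f by simp
      ultimately show "- b t * z t + k * f t > 0" by linarith
    qed
    with 1 show ?thesis by simp
  next
    case 2
    have "- z s > 0"
    proof (rule pos_of_deriv_pos_of_tendsto_at_bot[OF DERIV_minus[OF dz]])
      fix t assume "- z t \<le> 0"
      then have "b t * z t \<ge> 0" using b[of t] by simp
      moreover have "k * f t < 0" using 2 f by (simp add: mult_neg_pos)
      ultimately show "- (- b t * z t + k * f t) > 0" by linarith
    next
      show "((\<lambda>s. - z s) \<longlongrightarrow> 0) at_bot" using tendsto_minus[OF lim] by simp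
    qed
    with 2 show ?thesis by simp
  next
    case 3
    have "- (z s)\<^sup>2 \<ge> 0"
    proof (rule nonneg_of_deriv_nonneg_of_tendsto_at_bot[where a = "s + 1"
          and f = "\<lambda>s. - (z s)\<^sup>2"])
      fix t
      show "((\<lambda>s. - (z s)\<^sup>2) has_real_derivative 2 * b t * (z t)\<^sup>2) (at t)"
        using dz[of t] 3 by (auto intro!: derivative_eq_intros simp: power2_eq_square)
      show "2 * b t * (z t)\<^sup>2 \<ge> 0" using b[of t] by simp
    next
      show "((\<lambda>s. - (z s)\<^sup>2) \<longlongrightarrow> 0) at_bot"
        using tendsto_minus[OF tendsto_power[OF lim, of 2]] by simp
      show "s < s + 1" by simp
    qed
    with 3 show ?thesis by simp
  qed
  then show ?thesis by (simp add: z_def k_def l_def)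
qed

section \<open>Comparison with the explicit profile\<close>

text \<open>The profile has square root \<open>A / (A + E)\<close>, so its conserved quantity equals
  \<open>1 / A = sqrt 2 - 1\<close>; and \<open>1 / sqrt x - 1\<close> decreases in
  \<open>x\<close>.\<close>

lemma sgn_minus_U_approx:
  assumes "x > 0"
  shows "sgn (x - U_approx c s) =
    sgn (sqrt 2 - 1 - (1 / sqrt x - 1) * exp (- unstable_eigenvalue c * s))"
proof -
  define E where "E = exp (unstable_eigenvalue c * s)"
  define A where "A = 1 + sqrt 2"
  define r where "r = sqrt x"
  have E: "E > 0" by (simp add: E_def)
  have A: "A > 0" by (simp add: A_def add_pos_pos)
  have r: "r > 0" "x = r\<^sup>2" using assms by (simp_all add: r_def)
  have inv: "sqrt 2 - 1 = 1 / A"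
    using A by (simp add: A_def field_simps)
  have U: "U_approx c s = (A / (A + E))\<^sup>2"
    by (simp add: U_approx_def A_def E_def unstable_eigenvalue_def power_divide)
      (simp add: power2_eq_square algebra_simps)
  have "x - U_approx c s = (r - A / (A + E)) * (r + A / (A + E))"
    by (simp add: U r(2) power2_eq_square algebra_simps)
  moreover have "r + A / (A + E) > 0"
    using r(1) A E by (simp add: add_pos_pos)
  ultimately have "sgn (x - U_approx c s) = sgn (r - A / (A + E))"
    by (simp add: sgn_mult)
  also have "r - A / (A + E) = (1 / A - (1 / r - 1) / E) * (A * E * r / (A + E))"
    using r(1) A E by (simp add: field_simps add_pos_pos[THEN less_imp_neq, THEN not_sym])
  also have "sgn \<dots> = sgn (1 / A - (1 / r - 1) / E)"
    using r(1) A E by (simp add: sgn_mult)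
  finally show ?thesis
    by (simp add: inv r_def E_def exp_minus divide_inverse)
qed

lemma sgn_diff_of_sgn_deriv:
  fixes p p' :: "real \<Rightarrow> real"
  assumes deriv: "\<And>s. (p has_real_derivative p' s) (at s)"
    and sgn: "\<And>s. sgn (p' s) = \<sigma>"
  shows "sgn (p s - p 0) = \<sigma> * sgn s"
proof -
  consider "s < 0" | "s = 0" | "s > 0" by linarith
  then show ?thesis
  proof cases
    case 1
    then obtain t where "p 0 - p s = (0 - s) * p' t"
      using MVT2[of s 0 p p'] deriv by blast
    then have "p s - p 0 = s * p' t" by simp
    then show ?thesis using sgn[of t] by (simp add: sgn_mult)
  next
    case 3
    then obtain t where "p s - p 0 = (s - 0) * p' t"
      using MVT2[of 0 s p p'] deriv by blast
    then show ?thesis using sgn[of t] by (simp add: sgn_mult)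
  qed simp
qed

lemma sgn_kpp_heteroclinic_minus_U_approx:
  assumes c: "c \<ge> 2" and het: "kpp_heteroclinic c u v" and u0: "u 0 = 1 / 2"
  shows "sgn (u s - U_approx c s) = sgn (c - 5 / sqrt 6) * sgn s"
proof -
  note D = kpp_heteroclinicD[OF het]
  note u = kpp_heteroclinic_pos[OF c het]
  define l where "l = unstable_eigenvalue c"
  define z where "z = profile_defect c u v"
  \<comment> \<open>The minus sign gives the derivative of \<open>p\<close> the sign of the defect
    \<open>z\<close>.\<close>
  define p where "p = (\<lambda>s. - ((1 / sqrt (u s) - 1) * exp (- l * s)))"
  have "(p has_real_derivative exp (- l * t) / (2 * u t * sqrt (u t)) * z t) (at t)" for t
  proof -
    define \<rho> where "\<rho> = (\<lambda>s. sqrt (u s))"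
    define r where "r = sqrt (u t)"
    have r: "r > 0" "u t = r\<^sup>2" using u[of t] by (simp_all add: r_def)
    have "((\<lambda>s. sqrt (u s)) has_real_derivative v t / (2 * r)) (at t)"
      using DERIV_chain2[OF DERIV_real_sqrt[OF u] D(1), of t] by (simp add: r_def field_simps)
    then have dr: "((\<lambda>s. \<rho> s) has_real_derivative v t / (2 * r)) (at t)"
      by (simp add: \<rho>_def)
    have \<rho>: "\<rho> t = r" "p = (\<lambda>s. - ((1 / \<rho> s - 1) * exp (- l * s)))"
      by (simp_all add: p_def \<rho>_def r_def)
    have "(p has_real_derivative
        exp (- l * t) * (v t / (2 * r) / r\<^sup>2 + l * (1 / r - 1))) (at t)"
      unfolding \<rho>(2) using r
      by (auto intro!: derivative_eq_intros dr simp: \<rho>(1) field_simps power2_eq_square)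
    also have "exp (- l * t) * (v t / (2 * r) / r\<^sup>2 + l * (1 / r - 1))
        = exp (- l * t) / (2 * u t * r) * z t"
      unfolding z_def profile_defect_def l_def[symmetric] r_def[symmetric] r(2)
      using r(1) by (simp add: field_simps power2_eq_square)
    finally show ?thesis by (simp add: r_def)
  qed
  moreover have "sgn (exp (- l * t) / (2 * u t * sqrt (u t)) * z t) = sgn (c - 5 / sqrt 6)" for t
    using u[of t] sgn_profile_defect[OF c het]
    by (simp add: sgn_mult z_def sgn_speed_minus_critical)
  ultimately have "sgn (p s - p 0) = sgn (c - 5 / sqrt 6) * sgn s"
    by (rule sgn_diff_of_sgn_deriv)
  \<comment> \<open>The normalization \<open>u 0 = 1 / 2\<close> makes \<open>p 0\<close> agree with
    the constant of the profile, so \<open>p s - p 0\<close> has the sign of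
    \<open>u s - U_approx c s\<close>.\<close>
  moreover have "p 0 = - (sqrt 2 - 1)"
    by (simp add: p_def u0 real_sqrt_divide)
  ultimately show ?thesis
    using sgn_minus_U_approx[OF u, of s c s] by (simp add: p_def l_def algebra_simps)
qed

theorem theorem1p3:
  fixes c :: real and u v :: "real \<Rightarrow> real"
  assumes "c \<ge> 2"
    and "kpp_heteroclinic c u v"
    and "u 0 = 1 / 2"
  shows "(2 \<le> c \<and> c < 5 / sqrt 6 \<longrightarrow> (\<forall>s. sgn (u s - U_approx c s) = - sgn s)) \<and>
         (c = 5 / sqrt 6 \<longrightarrow> (\<forall>s. u s = U_approx c s)) \<and>
         (c > 5 / sqrt 6 \<longrightarrow> (\<forall>s. sgn (u s - U_approx c s) = sgn s))"
  \<comment> \<open>In the three regimes the factor \<open>sgn (c - 5 / sqrt 6)\<close> is -1, 0 and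
    1.\<close>
  using sgn_kpp_heteroclinic_minus_U_approx[OF assms] by (auto simp: sgn_zero_iff)

end
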